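(* Let $M$ be a CG-lattice $L$-module and let $N$ be a proper element of $M$. Then the following statements are equivalent: (1) $N$ is a pseudo-classical primary element of $M$. (2) $(N:X)=(N:rX)$ for all proper elements $r\in L$ and $X\in M$ such that $X\not\leqslant N$ and $rX\not\leqslant rad(N)$. (3) For every $r,s\in L_\ast$ and $K\in M_\ast$, if $rsK\leqslant N$ then either $rK\leqslant N$ or $sK\leqslant rad(N)$.
   Context: A multiplicative lattice $L$ is a complete lattice (least element $0$, greatest element $1$) with a commutative, associative multiplication that distributes over arbitrary joins and has $1$ as identity. An element $a$ of a complete lattice is compact if $a\leqslant \bigvee X$ implies $a\leqslant x_1\vee\cdots\vee x_n$ for finitely many $x_i\in X$; $L_\ast$ is the set of compact elements of $L$. Standing assumption: every element of $L$ is a join of compact elements of $L$, $1$ is compact, and finite products of compact elements of $L$ are compact. An element $a\in L$ is proper if $a<1$. An $L$-module $M$ is a complete lattice (least element $O_M$, greatest element $I_M$) with a multiplication $L\times M\to M$, $(a,A)\mapsto aA$, such that $(\bigvee_\alpha a_\alpha)A=\bigvee_\alpha a_\alpha A$, $a(\bigvee_\alpha A_\alpha)=\bigvee_\alpha aA_\alpha$, $(ab)A=a(bA)$, $1A=A$, $0A=O_M$. $M_\ast$ is the set of compact elements of $M$; $M$ is a CG-lattice $L$-module if each element of $M$ is a join of compact elements of $M$. For $A,B\in M$, $(A:B)=\bigvee\{x\in L\mid xB\leqslant A\}\in L$. $N\in M$ is proper if $N<I_M$. A proper $N\in M$ is prime if for all $a\in L$, $X\in M$, $aX\leqslant N$ implies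 $X\leqslant N$ or $aI_M\leqslant N$. For a proper $N$, $rad(N)=\bigwedge\{P\in M\mid P\text{ is prime and }N\leqslant P\}$ (the empty meet is $I_M$). A proper $N\in M$ is pseudo-classical primary if for all $a,b\in L$, $K\in M$, $abK\leqslant N$ implies $aK\leqslant N$ or $bK\leqslant rad(N)$. *)

theory Defs
  imports Main
begin

text \<open>
  The lattices of the theory are rendered as types of class \<^class>\<open>complete_lattice\<close>: the least
  and greatest elements \<open>0\<close>, \<open>1\<close> of \<open>L\<close> are \<open>bot\<close>, \<open>top\<close>, and those of \<open>M\<close> (\<open>O\<^sub>M\<close>, \<open>I\<^sub>M\<close>) are
  \<open>bot\<close>, \<open>top\<close> as well.
\<close>

definition (in complete_lattice) compact_elem :: "'a \<Rightarrow> bool" where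
  "compact_elem a \<longleftrightarrow> (\<forall>X. a \<le> Sup X \<longrightarrow> (\<exists>F. finite F \<and> F \<subseteq> X \<and> a \<le> Sup F))"

definition (in complete_lattice) compactly_generated :: "'a \<Rightarrow> bool" where
  "compactly_generated a \<longleftrightarrow> (\<exists>C. (\<forall>c\<in>C. compact_elem c) \<and> a = Sup C)"

definition (in complete_lattice) proper :: "'a \<Rightarrow> bool" where
  "proper a \<longleftrightarrow> a < top"

class multiplicative_lattice = complete_lattice + comm_monoid_mult +
  assumes mult_Sup: "a * Sup X = Sup ((\<lambda>x. a * x) ` X)"
    and one_eq_top: "1 = top"

text \<open>
  The standing assumption on \<open>L\<close>. Compactness of all finite products of compact elements is
  the binary case together with the compactness of the empty product \<open>1\<close>.
\<close>

class cg_multiplicative_lattice = multiplicative_lattice +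
  assumes compactly_generated: "compactly_generated a"
    and compact_one: "compact_elem 1"
    and compact_mult: "compact_elem a \<Longrightarrow> compact_elem b \<Longrightarrow> compact_elem (a * b)"

locale l_module =
  fixes smul :: "'l::multiplicative_lattice \<Rightarrow> 'm::complete_lattice \<Rightarrow> 'm"  (infixr \<open>\<odot>\<close> 75)
  assumes Sup_smul: "Sup S \<odot> A = Sup ((\<lambda>a. a \<odot> A) ` S)"
    and smul_Sup: "a \<odot> Sup T = Sup ((\<lambda>A. a \<odot> A) ` T)"
    and smul_assoc: "(a * b) \<odot> A = a \<odot> (b \<odot> A)"
    and one_smul: "1 \<odot> A = A"
    and bot_smul: "bot \<odot> A = bot"

locale cg_lattice_module = l_module smul
  for smul :: "'l::multiplicative_lattice \<Rightarrow> 'm::complete_lattice \<Rightarrow> 'm"  (infixr \<open>\<odot>\<close> 75) +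
  assumes compactly_generated: "compactly_generated (A :: 'm)"

definition residual ::
  "('l::multiplicative_lattice \<Rightarrow> 'm::complete_lattice \<Rightarrow> 'm) \<Rightarrow> 'm \<Rightarrow> 'm \<Rightarrow> 'l" where
  "residual smul A B = Sup {x. smul x B \<le> A}"

definition prime_element ::
  "('l::multiplicative_lattice \<Rightarrow> 'm::complete_lattice \<Rightarrow> 'm) \<Rightarrow> 'm \<Rightarrow> bool" where
  "prime_element smul N \<longleftrightarrow>
     proper N \<and> (\<forall>a X. smul a X \<le> N \<longrightarrow> X \<le> N \<or> smul a top \<le> N)"

text \<open>If no prime element lies above \<open>N\<close>, then \<open>radical smul N = top\<close>.\<close>

definition radical ::
  "('l::multiplicative_lattice \<Rightarrow> 'm::complete_lattice \<Rightarrow> 'm) \<Rightarrow> 'm \<Rightarrow> 'm" where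
  "radical smul N = Inf {P. prime_element smul P \<and> N \<le> P}"

definition pseudo_classical_primary ::
  "('l::multiplicative_lattice \<Rightarrow> 'm::complete_lattice \<Rightarrow> 'm) \<Rightarrow> 'm \<Rightarrow> bool" where
  "pseudo_classical_primary smul N \<longleftrightarrow>
     proper N \<and>
     (\<forall>a b K. smul (a * b) K \<le> N \<longrightarrow> smul a K \<le> N \<or> smul b K \<le> radical smul N)"

end

theory Submission
  imports Defs
begin

text \<open>
  The radical enters only through \<open>N \<le> rad N\<close>. Condition (2) is condition (1) rewritten with
  \<open>a X \<le> N \<longleftrightarrow> a \<le> (N : X)\<close>; the case \<open>r = 1\<close>, which (2) excludes, is trivial in (1). For (3) implies
  (1), a failure of (1) at \<open>a, b, K\<close> is witnessed by compact \<open>r \<le> a\<close>, \<open>K\<^sub>1 \<le> K\<close> with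
  \<open>r K\<^sub>1 \<le> N\<close> false and compact \<open>s \<le> b\<close>, \<open>K\<^sub>2 \<le> K\<close> with \<open>s K\<^sub>2 \<le> rad N\<close> false, and then (3) fails at
  \<open>r, s\<close> and the compact element \<open>K\<^sub>1 \<squnion> K\<^sub>2\<close>.
\<close>

text \<open>Finite subfamilies covering \<open>a\<close> and \<open>b\<close> separately unite to a
  finite one covering the join.\<close>

lemma compact_elem_sup:
  fixes a b :: "'a::complete_lattice"
  assumes "compact_elem a" and "compact_elem b"
  shows "compact_elem (sup a b)"
  unfolding compact_elem_def
proof (intro allI impI)
  fix X :: "'a set"
  assume "sup a b \<le> Sup X"
  with assms obtain F G where "finite F" "F \<subseteq> X" "a \<le> Sup F" and "finite G" "G \<subseteq> X" "b \<le> Sup G"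
    unfolding compact_elem_def by (meson le_sup_iff)
  then have "finite (F \<union> G) \<and> F \<union> G \<subseteq> X \<and> sup a b \<le> Sup (F \<union> G)"
    by (auto simp: Sup_union_distrib intro: le_supI1 le_supI2)
  then show "\<exists>H. finite H \<and> H \<subseteq> X \<and> sup a b \<le> Sup H" by blast
qed

lemma le_radical: "N \<le> radical smul N"
  unfolding radical_def by (rule Inf_greatest) blast

context l_module
begin

lemma sup_smul: "sup a b \<odot> A = sup (a \<odot> A) (b \<odot> A)"
  using Sup_smul[of "{a, b}" A] by simp

lemma smul_sup: "a \<odot> sup A B = sup (a \<odot> A) (a \<odot> B)"
  using smul_Sup[of a "{A, B}"] by simp

lemma smul_mono: "a \<le> b \<Longrightarrow> A \<le> B \<Longrightarrow> a \<odot> A \<le> b \<odot> B"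
  by (metis le_iff_sup order_trans smul_sup sup_smul sup_ge1)

lemma smul_le: "a \<odot> A \<le> A"
  using smul_mono[of a 1 A A] by (simp add: one_eq_top one_smul[unfolded one_eq_top])

text \<open>Multiplication by \<open>X\<close> preserves joins, so the join defining
  \<open>residual\<close> is itself a member of the set: \<open>(N : X) X \<le> N\<close>. This
  makes the residual right adjoint to \<open>a \<mapsto> a X\<close>.\<close>

lemma le_residual_iff: "a \<le> residual smul N X \<longleftrightarrow> a \<odot> X \<le> N"
proof
  assume "a \<le> residual smul N X"
  then have "a \<odot> X \<le> residual smul N X \<odot> X" by (simp add: smul_mono)
  also have "\<dots> \<le> N" unfolding residual_def Sup_smul by (rule Sup_least) blast
  finally show "a \<odot> X \<le> N" .
next
  assume "a \<odot> X \<le> N"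
  then show "a \<le> residual smul N X" unfolding residual_def by (simp add: Sup_upper)
qed

text \<open>Since \<open>r X \<le> X\<close>, this half of the equality in (2) holds for all
  \<open>r\<close> and \<open>X\<close>; only the reverse inequality reflects primariness.\<close>

lemma residual_le_residual_smul: "residual smul N X \<le> residual smul N (r \<odot> X)"
proof -
  have "residual smul N X \<odot> (r \<odot> X) \<le> residual smul N X \<odot> X"
    by (simp add: smul_mono smul_le)
  also have "\<dots> \<le> N" by (simp flip: le_residual_iff)
  finally show ?thesis by (simp add: le_residual_iff)
qed

lemma pseudo_classical_primary_iff_residual:
  assumes "proper N"
  shows "pseudo_classical_primary smul N \<longleftrightarrow>
    (\<forall>r X. proper r \<and> \<not> X \<le> N \<and> \<not> r \<odot> X \<le> radical smul N \<longrightarrow>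
      residual smul N X = residual smul N (r \<odot> X))" (is "_ \<longleftrightarrow> ?R")
proof
  assume prim: "pseudo_classical_primary smul N"
  have "residual smul N X = residual smul N (r \<odot> X)" if "\<not> r \<odot> X \<le> radical smul N" for r X
  proof (rule antisym[OF residual_le_residual_smul])
    let ?a = "residual smul N (r \<odot> X)"
    \<comment> \<open>By associativity and the adjunction this is just
      \<open>?a \<le> ?a\<close>.\<close>
    have "(?a * r) \<odot> X \<le> N" by (simp add: smul_assoc flip: le_residual_iff)
    with prim that have "?a \<odot> X \<le> N" unfolding pseudo_classical_primary_def by blast
    then show "?a \<le> residual smul N X" by (simp add: le_residual_iff)
  qed
  then show ?R by blast
next
  assume R: ?R
  have "a \<odot> K \<le> N" if le: "(a * b) \<odot> K \<le> N" and nle: "\<not> b \<odot> K \<le> radical smul N" for a b K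
  proof (cases "proper b")
    case True
    \<comment> \<open>Otherwise \<open>b K \<le> K \<le> N \<le> rad N\<close>, against
      \<open>nle\<close>.\<close>
    have "\<not> K \<le> N" using nle smul_le[of b K] le_radical[of N smul] by (meson order_trans)
    with R True nle have "residual smul N K = residual smul N (b \<odot> K)" by blast
    with le show ?thesis by (metis le_residual_iff smul_assoc)
  next
    case False
    then have "b = 1" by (simp add: proper_def one_eq_top flip: less_top)
    with le show ?thesis by simp
  qed
  with assms show "pseudo_classical_primary smul N"
    unfolding pseudo_classical_primary_def by blast
qed

text \<open>Multiplication preserves joins in each argument, so \<open>a A\<close> is the join of
  the products \<open>c C\<close> of compact generators; if all of them were below \<open>B\<close>,
  so would be \<open>a A\<close>.\<close>

lemma not_smul_leE:
  assumes "compactly_generated a" and "compactly_generated A" and "\<not> a \<odot> A \<le> B"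
  obtains c C where "compact_elem c" "compact_elem C" "c \<le> a" "C \<le> A" "\<not> c \<odot> C \<le> B"
proof -
  obtain S T where S: "\<forall>c\<in>S. compact_elem c" "a = Sup S" and T: "\<forall>C\<in>T. compact_elem C" "A = Sup T"
    using assms(1,2) unfolding compactly_generated_def by blast
  obtain c where c: "c \<in> S" "\<not> c \<odot> A \<le> B"
    using assms(3) unfolding S(2) Sup_smul by (auto simp: Sup_le_iff)
  obtain C where C: "C \<in> T" "\<not> c \<odot> C \<le> B"
    using c(2) unfolding T(2) smul_Sup by (auto simp: Sup_le_iff)
  show thesis using that[of c C] c C S T by (simp add: Sup_upper)
qed

end

text \<open>The locale provides compact generation of the module only; \<open>cg\<close> adds it for
  the lattice of scalars.\<close>

lemma (in cg_lattice_module) pseudo_classical_primary_iff_compact: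
  assumes "proper N" and cg: "\<And>a :: 'l. compactly_generated a"
  shows "pseudo_classical_primary smul N \<longleftrightarrow>
    (\<forall>r s K. compact_elem r \<and> compact_elem s \<and> compact_elem K \<longrightarrow>
      (r * s) \<odot> K \<le> N \<longrightarrow> r \<odot> K \<le> N \<or> s \<odot> K \<le> radical smul N)" (is "_ \<longleftrightarrow> ?R")
proof
  assume "pseudo_classical_primary smul N"
  then show ?R unfolding pseudo_classical_primary_def by blast
next
  assume R: ?R
  have False
    if le: "(a * b) \<odot> K \<le> N" and na: "\<not> a \<odot> K \<le> N" and nb: "\<not> b \<odot> K \<le> radical smul N" for a b K
  proof -
    obtain r K1 where r: "compact_elem r" "compact_elem K1" "r \<le> a" "K1 \<le> K" "\<not> r \<odot> K1 \<le> N"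
      using not_smul_leE[OF cg compactly_generated na] .
    obtain s K2 where s: "compact_elem s" "compact_elem K2" "s \<le> b" "K2 \<le> K"
      "\<not> s \<odot> K2 \<le> radical smul N"
      using not_smul_leE[OF cg compactly_generated nb] .
    have "(r * s) \<odot> sup K1 K2 \<le> (a * b) \<odot> K"
      unfolding smul_assoc using r(3,4) s(3,4) by (simp add: smul_mono)
    with le have "(r * s) \<odot> sup K1 K2 \<le> N" by (rule order_trans[rotated])
    with R compact_elem_sup[OF r(2) s(2)] r(1) s(1)
    have "r \<odot> sup K1 K2 \<le> N \<or> s \<odot> sup K1 K2 \<le> radical smul N" by blast
    \<comment> \<open>Distributing over the join, the first alternative would give
      \<open>r K1 \<le> N\<close> and the second \<open>s K2 \<le> rad N\<close>.\<close>
    with r(5) s(5) show False by (simp add: smul_sup)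
  qed
  with assms(1) show "pseudo_classical_primary smul N"
    unfolding pseudo_classical_primary_def by blast
qed

theorem theorem4p2:
  fixes smul :: "'l::cg_multiplicative_lattice \<Rightarrow> 'm::complete_lattice \<Rightarrow> 'm"  (infixr \<open>\<odot>\<close> 75)
    and N :: 'm
  assumes "cg_lattice_module smul"
    and "proper N"
  shows "(pseudo_classical_primary smul N \<longleftrightarrow>
           (\<forall>(r :: 'l) (X :: 'm). proper r \<and> \<not> X \<le> N \<and> \<not> r \<odot> X \<le> radical smul N \<longrightarrow>
              residual smul N X = residual smul N (r \<odot> X))) \<and>
         (pseudo_classical_primary smul N \<longleftrightarrow>
           (\<forall>(r :: 'l) (s :: 'l) (K :: 'm). compact_elem r \<and> compact_elem s \<and> compact_elem K \<longrightarrow>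
              (r * s) \<odot> K \<le> N \<longrightarrow> r \<odot> K \<le> N \<or> s \<odot> K \<le> radical smul N))"
proof -
  interpret cg_lattice_module smul by fact
  show ?thesis
    using pseudo_classical_primary_iff_residual[OF assms(2)]
      pseudo_classical_primary_iff_compact[OF assms(2) cg_multiplicative_lattice_class.compactly_generated]
    by blast
qed

end
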